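(* Let $\Gamma$ be a finitely generated group acting as a group of homeomorphisms on a compact metrizable space $X$. Then there exists a metric $d$ on $X$ defining the original topology of $X$ such that $\Gamma$ acts on $(X,d)$ by bi-Lipschitz transformations, i.e. for every $\psi\in\Gamma$ there is a constant $L_\psi\ge 1$ with $L_\psi^{-1}d(x,y)\le d(\psi x,\psi y)\le L_\psi\, d(x,y)$ for all $x,y\in X$.
   Context: The bi-Lipschitz constant is allowed to depend on the group element. The topology on $X$ is the given compact metrizable one, with respect to which each element of $\Gamma$ acts as a homeomorphism. *)

theory Defs
  imports
    "HOL-Analysis.Analysis"
    "HOL-Algebra.Generated_Groups"
    "HOL-Algebra.Group_Action"
begin

definition finitely_generated_group :: "('g, 'm) monoid_scheme \<Rightarrow> bool" where
  "finitely_generated_group G \<longleftrightarrow>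
     group G \<and> (\<exists>S. finite S \<and> S \<subseteq> carrier G \<and> generate G S = carrier G)"

(* The action is not required to be faithful. *)
definition acts_by_homeomorphisms ::
  "('g, 'm) monoid_scheme \<Rightarrow> 'x topology \<Rightarrow> ('g \<Rightarrow> 'x \<Rightarrow> 'x) \<Rightarrow> bool" where
  "acts_by_homeomorphisms G X \<phi> \<longleftrightarrow>
     group_action G (topspace X) \<phi> \<and> (\<forall>g\<in>carrier G. homeomorphic_map X X (\<phi> g))"

definition bi_lipschitz_transformation ::
  "'x set \<Rightarrow> ('x \<Rightarrow> 'x \<Rightarrow> real) \<Rightarrow> ('x \<Rightarrow> 'x) \<Rightarrow> bool" where
  "bi_lipschitz_transformation M d f \<longleftrightarrow>
     bij_betw f M M \<and>
     (\<exists>L\<ge>1. \<forall>x\<in>M. \<forall>y\<in>M. inverse L * d x y \<le> d (f x) (f y) \<and> d (f x) (f y) \<le> L * d x y)"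

end

theory Submission
  imports Defs
begin

text \<open>
  Capping a metric of \<open>X\<close> gives a compatible metric \<open>d\<^sub>0 \<le> 1\<close>. For a finite set \<open>F\<close> of continuous
  self-maps, let words over \<open>F\<close> act by composition and put
  \[ d(x,y) = \sup_w 2^{-|w|} d_0(w x, w y). \]
  Applying \<open>f \<in> F\<close> to both points lengthens every word by one letter, which costs only a factor 2,
  so every \<open>f \<in> F\<close> is 2-Lipschitz for \<open>d\<close>. The empty word shows \<open>d\<^sub>0 \<le> d\<close>. Conversely, long words
  contribute little because \<open>d\<^sub>0\<close> is bounded, and there are only finitely many short words, each of
  which acts continuously; hence \<open>d\<close> induces the same topology as \<open>d\<^sub>0\<close>. This is
  \<open>finite_family_Lipschitz_metric\<close>.

  For a finitely generated group, take \<open>F\<close> to be the set of transformations given by a finite set of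
  generators and their inverses. Lipschitz maps are closed under composition, so every group
  element is Lipschitz for \<open>d\<close>, and since its inverse is Lipschitz as well, it is bi-Lipschitz.
\<close>

section \<open>The weighted supremum metric over words\<close>

text \<open>
  The first letter of a word acts first, so that prefixing a letter to a word amounts to applying
  that letter to the points.
\<close>

definition word_map :: "('a \<Rightarrow> 'a) list \<Rightarrow> 'a \<Rightarrow> 'a" where
  "word_map w = fold (\<lambda>f. f) w"

definition word_dist ::
  "('a \<Rightarrow> 'a) set \<Rightarrow> ('a \<Rightarrow> 'a \<Rightarrow> real) \<Rightarrow> 'a \<Rightarrow> 'a \<Rightarrow> real" where
  "word_dist F d x y =
     (SUP w\<in>lists F. (1/2) ^ length w * d (word_map w x) (word_map w y))"

lemma word_map_Nil [simp]: "word_map [] x = x"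
  and word_map_Cons [simp]: "word_map (f # w) x = word_map w (f x)"
  by (simp_all add: word_map_def)

lemma continuous_map_word_map:
  assumes "\<And>f. f \<in> F \<Longrightarrow> continuous_map X X f" and "w \<in> lists F"
  shows "continuous_map X X (word_map w)"
  using assms(2)
proof (induction w)
  case Nil
  have "word_map [] = id" by auto
  then show ?case by simp
next
  case (Cons f w)
  have "word_map (f # w) = word_map w \<circ> f" by auto
  then show ?case using Cons assms(1) continuous_map_compose by metis
qed

context
  fixes F :: "('a \<Rightarrow> 'a) set" and d :: "'a \<Rightarrow> 'a \<Rightarrow> real"
  assumes nonneg: "\<And>x y. 0 \<le> d x y" and le_1: "\<And>x y. d x y \<le> 1"
begin

lemma word_dist_upper:
  assumes "w \<in> lists F"
  shows "(1/2) ^ length w * d (word_map w x) (word_map w y) \<le> word_dist F d x y"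
proof -
  have "(1/2) ^ length v * d (word_map v x) (word_map v y) \<le> 1" for v
    by (intro mult_le_one power_le_one nonneg le_1) auto
  then have "bdd_above ((\<lambda>w. (1/2) ^ length w * d (word_map w x) (word_map w y)) ` lists F)"
    by (auto intro!: bdd_aboveI)
  then show ?thesis
    unfolding word_dist_def using assms by (rule cSUP_upper2) auto
qed

lemma word_dist_least:
  assumes "\<And>w. w \<in> lists F \<Longrightarrow> (1/2) ^ length w * d (word_map w x) (word_map w y) \<le> c"
  shows "word_dist F d x y \<le> c"
  unfolding word_dist_def by (rule cSUP_least) (use assms in auto)

lemma le_word_dist: "d x y \<le> word_dist F d x y"
  using word_dist_upper[of "[]" x y] by simp

text \<open>
  The term of \<open>w\<close> for the image points is twice the term of \<open>f # w\<close> for the original points.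
\<close>

lemma word_dist_letter_le:
  assumes "f \<in> F"
  shows "word_dist F d (f x) (f y) \<le> 2 * word_dist F d x y"
proof (rule word_dist_least)
  fix w assume "w \<in> lists F"
  then show "(1/2) ^ length w * d (word_map w (f x)) (word_map w (f y)) \<le> 2 * word_dist F d x y"
    using word_dist_upper[of "f # w" x y] assms by simp
qed

lemma Metric_space_word_dist:
  assumes "Metric_space M d" and "\<And>w. w \<in> lists F \<Longrightarrow> word_map w \<in> M \<rightarrow> M"
  shows "Metric_space M (word_dist F d)"
proof
  interpret Metric_space M d by fact
  fix x y z
  show "0 \<le> word_dist F d x y"
    using nonneg le_word_dist order_trans by blast
  show "word_dist F d x y = word_dist F d y x"
    by (simp add: word_dist_def commute)
  assume x: "x \<in> M" and y: "y \<in> M"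
  show "word_dist F d x y = 0 \<longleftrightarrow> x = y"
  proof
    assume "word_dist F d x y = 0"
    then have "d x y = 0" using le_word_dist[of x y] nonneg[of x y] by simp
    then show "x = y" using x y by simp
  next
    assume "x = y"
    have "word_dist F d y y \<le> 0"
      using assms(2) y by (intro word_dist_least) (auto simp: Pi_iff)
    then have "word_dist F d y y = 0"
      using le_word_dist[of y y] nonneg[of y y] by linarith
    then show "word_dist F d x y = 0" by (simp only: \<open>x = y\<close>)
  qed
  assume z: "z \<in> M"
  show "word_dist F d x z \<le> word_dist F d x y + word_dist F d y z"
  proof (rule word_dist_least)
    fix w assume w: "w \<in> lists F"
    let ?w = "word_map w"
    have "d (?w x) (?w z) \<le> d (?w x) (?w y) + d (?w y) (?w z)"
      using assms(2)[OF w] x y z by (intro triangle) auto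
    then have "(1/2) ^ length w * d (?w x) (?w z) \<le>
        (1/2) ^ length w * (d (?w x) (?w y) + d (?w y) (?w z))"
      by (intro mult_left_mono) auto
    also have "\<dots> \<le> word_dist F d x y + word_dist F d y z"
      using word_dist_upper[OF w, of x y] word_dist_upper[OF w, of y z] by (simp add: distrib_left)
    finally show "(1/2) ^ length w * d (?w x) (?w z) \<le> word_dist F d x y + word_dist F d y z" .
  qed
qed

text \<open>
  Since \<open>d \<le> 1\<close>, a word of weight at most \<open>\<epsilon> / 2\<close> contributes at most \<open>\<epsilon> / 2\<close> whatever the points
  are. As \<open>F\<close> is finite, only finitely many words have larger weight, and continuity of their action
  gives a neighbourhood of \<open>x\<close> on which they contribute at most \<open>\<epsilon> / 2\<close> as well.
\<close>

lemma word_dist_small_nhd: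
  assumes "Metric_space M d" and "finite F"
    and cont: "\<And>f. f \<in> F \<Longrightarrow>
      continuous_map (Metric_space.mtopology M d) (Metric_space.mtopology M d) f"
    and "x \<in> M" and "\<epsilon> > 0"
  shows "\<exists>U. openin (Metric_space.mtopology M d) U \<and> x \<in> U \<and> (\<forall>y\<in>U. word_dist F d x y < \<epsilon>)"
proof -
  interpret Metric_space M d by fact
  obtain n where n: "(1/2 :: real) ^ n < \<epsilon> / 2"
    using real_arch_pow_inv[of "\<epsilon> / 2" "1/2"] \<open>\<epsilon> > 0\<close> by auto
  define W where "W = {w. set w \<subseteq> F \<and> length w \<le> n}"
  define U where
    "U = (\<Inter>w\<in>W. {y \<in> topspace mtopology. word_map w y \<in> mball (word_map w x) (\<epsilon> / 2)})"
  have "finite W"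
    unfolding W_def using \<open>finite F\<close> by (rule finite_lists_length_le)
  have "[] \<in> W" by (simp add: W_def)
  have contW: "continuous_map mtopology mtopology (word_map w)" if "w \<in> lists F" for w
    using continuous_map_word_map cont that by blast
  have WF: "w \<in> lists F" if "w \<in> W" for w
    using that by (auto simp: W_def in_lists_conv_set)
  have "openin mtopology U"
    unfolding U_def using \<open>finite W\<close> \<open>[] \<in> W\<close>
    by (intro openin_INT2 openin_continuous_map_preimage[OF contW] WF openin_mball) auto
  moreover have "word_map w x \<in> M" if "w \<in> W" for w
    using contW[OF WF[OF that]] \<open>x \<in> M\<close> by (auto simp: continuous_map_def)
  then have "x \<in> U"
    using \<open>x \<in> M\<close> \<open>\<epsilon> > 0\<close> by (simp add: U_def)
  moreover have "word_dist F d x y < \<epsilon>" if "y \<in> U" for y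
  proof -
    have "word_dist F d x y \<le> \<epsilon> / 2"
    proof (rule word_dist_least)
      fix w assume w: "w \<in> lists F"
      let ?a = "(1/2 :: real) ^ length w" and ?b = "d (word_map w x) (word_map w y)"
      show "?a * ?b \<le> \<epsilon> / 2"
      proof (cases "length w \<le> n")
        case True
        then have "w \<in> W" using w by (auto simp: W_def)
        then have "?b \<le> \<epsilon> / 2" using \<open>y \<in> U\<close> by (auto simp: U_def)
        moreover have "?a * ?b \<le> 1 * ?b"
          by (intro mult_right_mono power_le_one nonneg) auto
        ultimately show ?thesis by simp
      next
        case False
        then have "?a \<le> (1/2) ^ n" by (intro power_decreasing) auto
        moreover have "?a * ?b \<le> ?a * 1" by (intro mult_left_mono le_1) auto
        ultimately show ?thesis using n by linarith
      qed
    qed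
    then show ?thesis using \<open>\<epsilon> > 0\<close> by simp
  qed
  ultimately show ?thesis by blast
qed

lemma mtopology_word_dist:
  assumes d: "Metric_space M d" and "finite F"
    and cont: "\<And>f. f \<in> F \<Longrightarrow>
      continuous_map (Metric_space.mtopology M d) (Metric_space.mtopology M d) f"
  shows "Metric_space M (word_dist F d)"
    and "Metric_space.mtopology M (word_dist F d) = Metric_space.mtopology M d"
proof -
  interpret Metric_space M d by fact
  have "word_map w \<in> M \<rightarrow> M" if "w \<in> lists F" for w
    using continuous_map_word_map[OF cont that] by (simp add: continuous_map_def)
  then show ms: "Metric_space M (word_dist F d)"
    using d by (rule Metric_space_word_dist[rotated])
  interpret W: Metric_space M "word_dist F d" by fact
  have "continuous_map mtopology W.mtopology id"
    unfolding W.continuous_map_to_metric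
  proof (intro ballI allI impI)
    fix x and \<epsilon> :: real assume "x \<in> topspace mtopology" "\<epsilon> > 0"
    then obtain U where "openin mtopology U" "x \<in> U" "\<forall>y\<in>U. word_dist F d x y < \<epsilon>"
      using word_dist_small_nhd[OF d \<open>finite F\<close> cont, of x \<epsilon>] by auto
    moreover have "U \<subseteq> M" using \<open>openin mtopology U\<close> openin_subset by force
    ultimately show "\<exists>U. openin mtopology U \<and> x \<in> U \<and> (\<forall>y\<in>U. id y \<in> W.mball (id x) \<epsilon>)"
      by (intro exI[of _ U]) auto
  qed
  moreover have "continuous_map W.mtopology mtopology id"
    unfolding continuous_map_to_metric
  proof (intro ballI allI impI)
    fix x and \<epsilon> :: real assume "x \<in> topspace W.mtopology" "\<epsilon> > 0"
    moreover have "W.mball x \<epsilon> \<subseteq> mball x \<epsilon>"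
      using le_less_trans[OF le_word_dist] by auto
    ultimately show "\<exists>U. openin W.mtopology U \<and> x \<in> U \<and> (\<forall>y\<in>U. id y \<in> mball (id x) \<epsilon>)"
      by (intro exI[of _ "W.mball x \<epsilon>"]) auto
  qed
  ultimately show "W.mtopology = mtopology"
    using topology_finer_continuous_id[of mtopology W.mtopology]
      topology_finer_continuous_id[of W.mtopology mtopology]
    unfolding topology_eq by auto
qed

end

lemma finite_family_Lipschitz_metric:
  assumes "metrizable_space X" and "finite F" and "\<And>f. f \<in> F \<Longrightarrow> continuous_map X X f"
  shows "\<exists>d. Metric_space (topspace X) d \<and> Metric_space.mtopology (topspace X) d = X \<and>
             (\<forall>f\<in>F. \<forall>x y. d (f x) (f y) \<le> 2 * d x y)"
proof -
  obtain M d where d: "Metric_space M d" and X: "X = Metric_space.mtopology M d"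
    using assms(1) unfolding metrizable_space_def by blast
  interpret Metric_space M d by fact
  let ?e = "capped_dist 1"
  have e: "Metric_space M ?e" "Metric_space.mtopology M ?e = X"
    using X by (simp_all add: capped_dist mtopology_capped_metric)
  have nonneg: "0 \<le> ?e x y" and le_1: "?e x y \<le> 1" for x y
    by (auto simp: capped_dist_def)
  have "continuous_map (Metric_space.mtopology M ?e) (Metric_space.mtopology M ?e) f" if "f \<in> F" for f
    using assms(3) that e(2) by simp
  note mtopology_word_dist[of ?e, OF nonneg le_1 e(1) \<open>finite F\<close> this]
  moreover have "topspace X = M" using X by simp
  moreover have "\<forall>f\<in>F. \<forall>x y. word_dist F ?e (f x) (f y) \<le> 2 * word_dist F ?e x y"
    using word_dist_letter_le[of ?e, OF nonneg le_1] by blast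
  ultimately show ?thesis
    using e(2) by (intro exI[of _ "word_dist F ?e"]) simp
qed

section \<open>Lipschitz group actions\<close>

text \<open>
  Lipschitz constants multiply under composition. A constant that is at least 1 is in particular
  nonnegative, which the estimate for a product uses, and it can serve as a bi-Lipschitz constant.
\<close>

lemma Lipschitz_on_generate:
  assumes act: "group_action G M \<phi>" and S: "S \<subseteq> carrier G"
    and nonneg: "\<And>x y. 0 \<le> (d x y :: real)"
    and gen: "\<And>s. s \<in> S \<Longrightarrow> \<exists>L. \<forall>x\<in>M. \<forall>y\<in>M. d (\<phi> s x) (\<phi> s y) \<le> L * d x y"
    and inv: "\<And>s. s \<in> S \<Longrightarrow> \<exists>L. \<forall>x\<in>M. \<forall>y\<in>M. d (\<phi> (inv\<^bsub>G\<^esub> s) x) (\<phi> (inv\<^bsub>G\<^esub> s) y) \<le> L * d x y"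
    and "g \<in> generate G S"
  shows "\<exists>L\<ge>1. \<forall>x\<in>M. \<forall>y\<in>M. d (\<phi> g x) (\<phi> g y) \<le> L * d x y"
  using \<open>g \<in> generate G S\<close>
proof (induction g rule: generate.induct)
  interpret group_action G M \<phi> by fact
  interpret group G using act by (simp add: group_action_def group_hom_def)
  have weaken: "\<exists>L\<ge>1. \<forall>x\<in>M. \<forall>y\<in>M. d (f x) (f y) \<le> L * d x y"
    if "\<exists>L. \<forall>x\<in>M. \<forall>y\<in>M. d (f x) (f y) \<le> L * d x y" for f
  proof -
    from that obtain L where L: "\<forall>x\<in>M. \<forall>y\<in>M. d (f x) (f y) \<le> L * d x y" by blast
    have "L * d x y \<le> max 1 L * d x y" for x y
      by (intro mult_right_mono nonneg) simp
    with L have "\<forall>x\<in>M. \<forall>y\<in>M. d (f x) (f y) \<le> max 1 L * d x y"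
      by (meson order_trans)
    then show ?thesis by (intro exI[of _ "max 1 L"]) simp
  qed
  {
    case one
    have "\<phi> \<one>\<^bsub>G\<^esub> x = x" if "x \<in> M" for x
      using that by (simp flip: id_eq_one)
    then show ?case by (intro exI[of _ 1]) simp
  next
    case (incl s)
    then show ?case using gen weaken by blast
  next
    case (inv s)
    then show ?case using assms(5) weaken by blast
  next
    case (eng g h)
    obtain K where K: "K \<ge> 1" "\<forall>x\<in>M. \<forall>y\<in>M. d (\<phi> g x) (\<phi> g y) \<le> K * d x y"
      using eng.IH by blast
    obtain L where L: "\<forall>x\<in>M. \<forall>y\<in>M. d (\<phi> h x) (\<phi> h y) \<le> L * d x y"
      using eng.IH by blast
    have gh: "g \<in> carrier G" "h \<in> carrier G"
      using eng.hyps generate_in_carrier[OF S] by auto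
    have "d (\<phi> (g \<otimes>\<^bsub>G\<^esub> h) x) (\<phi> (g \<otimes>\<^bsub>G\<^esub> h) y) \<le> (K * L) * d x y" if "x \<in> M" "y \<in> M" for x y
    proof -
      have "d (\<phi> (g \<otimes>\<^bsub>G\<^esub> h) x) (\<phi> (g \<otimes>\<^bsub>G\<^esub> h) y) = d (\<phi> g (\<phi> h x)) (\<phi> g (\<phi> h y))"
        using gh that by (simp add: composition_rule)
      also have "\<dots> \<le> K * d (\<phi> h x) (\<phi> h y)"
        using K(2) gh that element_image by blast
      also have "\<dots> \<le> K * (L * d x y)"
        using K(1) L that by (intro mult_left_mono) auto
      finally show ?thesis by (simp add: mult.assoc)
    qed
    then show ?case by (intro weaken) blast
  }
qed

text \<open>
  The lower bound for \<open>g\<close> is the Lipschitz bound of its inverse, applied to the image points.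
\<close>

lemma bi_lipschitz_transformation_action:
  assumes act: "group_action G M \<phi>" and g: "g \<in> carrier G"
    and nonneg: "\<And>x y. 0 \<le> d x y"
    and lip: "\<And>h. h \<in> carrier G \<Longrightarrow> \<exists>L\<ge>1. \<forall>x\<in>M. \<forall>y\<in>M. d (\<phi> h x) (\<phi> h y) \<le> L * d x y"
  shows "bi_lipschitz_transformation M d (\<phi> g)"
proof -
  interpret group_action G M \<phi> by fact
  interpret group G using act by (simp add: group_action_def group_hom_def)
  obtain K where K: "K \<ge> 1" "\<forall>x\<in>M. \<forall>y\<in>M. d (\<phi> g x) (\<phi> g y) \<le> K * d x y"
    using lip g by blast
  obtain L where L: "L \<ge> 1"
    "\<forall>x\<in>M. \<forall>y\<in>M. d (\<phi> (inv\<^bsub>G\<^esub> g) x) (\<phi> (inv\<^bsub>G\<^esub> g) y) \<le> L * d x y"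
    using lip g inv_closed by blast
  have "inverse (max K L) * d x y \<le> d (\<phi> g x) (\<phi> g y) \<and> d (\<phi> g x) (\<phi> g y) \<le> max K L * d x y"
    if "x \<in> M" "y \<in> M" for x y
  proof
    have "d x y = d (\<phi> (inv\<^bsub>G\<^esub> g) (\<phi> g x)) (\<phi> (inv\<^bsub>G\<^esub> g) (\<phi> g y))"
      using that g by (simp add: orbit_sym_aux)
    also have "\<dots> \<le> L * d (\<phi> g x) (\<phi> g y)"
      using L(2) g that element_image by blast
    also have "\<dots> \<le> max K L * d (\<phi> g x) (\<phi> g y)"
      by (intro mult_right_mono nonneg) simp
    finally show "inverse (max K L) * d x y \<le> d (\<phi> g x) (\<phi> g y)"
      using K(1) by (simp add: field_simps)
    have "K * d x y \<le> max K L * d x y"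
      by (intro mult_right_mono nonneg) simp
    then show "d (\<phi> g x) (\<phi> g y) \<le> max K L * d x y"
      using K(2) that order_trans by blast
  qed
  moreover have "bij_betw (\<phi> g) M M"
    using bij_prop0 g by (auto simp: Bij_def)
  ultimately show ?thesis
    unfolding bi_lipschitz_transformation_def using K(1) by (auto intro!: exI[of _ "max K L"])
qed

theorem theorem2:
  fixes G :: "('g, 'm) monoid_scheme"
    and X :: "'x topology"
    and \<phi> :: "'g \<Rightarrow> 'x \<Rightarrow> 'x"
  assumes "finitely_generated_group G"
    and "compact_space X"
    and "metrizable_space X"
    and "acts_by_homeomorphisms G X \<phi>"
  shows "\<exists>d. Metric_space (topspace X) d \<and>
             Metric_space.mtopology (topspace X) d = X \<and>
             (\<forall>\<psi>\<in>carrier G. bi_lipschitz_transformation (topspace X) d (\<phi> \<psi>))"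
proof -
  obtain S where S: "finite S" "S \<subseteq> carrier G" "generate G S = carrier G" and "group G"
    using assms(1) unfolding finitely_generated_group_def by blast
  interpret group G by fact
  have act: "group_action G (topspace X) \<phi>"
    and homeo: "\<And>g. g \<in> carrier G \<Longrightarrow> homeomorphic_map X X (\<phi> g)"
    using assms(4) by (auto simp: acts_by_homeomorphisms_def)
  define F where "F = \<phi> ` (S \<union> m_inv G ` S)"
  have "finite F" using S(1) by (simp add: F_def)
  moreover have "continuous_map X X f" if "f \<in> F" for f
  proof -
    obtain g where "g \<in> carrier G" "f = \<phi> g"
      using \<open>f \<in> F\<close> S(2) by (auto simp: F_def)
    then show ?thesis using homeo homeomorphic_imp_continuous_map by blast
  qed
  ultimately obtain d where d: "Metric_space (topspace X) d"
      "Metric_space.mtopology (topspace X) d = X"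
    and lip: "\<forall>f\<in>F. \<forall>x y. d (f x) (f y) \<le> 2 * d x y"
    using finite_family_Lipschitz_metric[OF assms(3)] by metis
  have nonneg: "0 \<le> d x y" for x y
    using d(1) by (simp add: Metric_space.nonneg)
  have "\<exists>L\<ge>1. \<forall>x\<in>topspace X. \<forall>y\<in>topspace X. d (\<phi> g x) (\<phi> g y) \<le> L * d x y"
    if "g \<in> carrier G" for g
    using Lipschitz_on_generate[OF act S(2), of d g] nonneg lip that S(3)
    unfolding F_def by blast
  then have "\<forall>\<psi>\<in>carrier G. bi_lipschitz_transformation (topspace X) d (\<phi> \<psi>)"
    using bi_lipschitz_transformation_action[OF act] nonneg by blast
  with d show ?thesis by blast
qed

end
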